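(* Let $I=[-1,1]$, $\varepsilon>0$, and let $\{f_{1,t},\dots,f_{n,t}\}$, $f_{k,t}(x)=\lambda x+a_k+b_k t$, be the random iterated function system described in the context, with probabilities $0<p_k\le 1$, $\sum_{k=1}^n p_k=1$, and with $t$ distributed on $[0,\varepsilon]$ with smooth probability density $h$. Let $\mu$ be its unique invariant probability measure on $I$. Then $\mu$ is absolutely continuous with respect to Lebesgue measure on $I$, with a density $\phi\in\mathcal{C}^\infty(I)$, and for every integer $k\ge 0$ $$\sup_I|\phi^{(k)}|\le|\lambda|^{-\frac{(k+1)(k+2)}{2}}\biggl(\sum_{i=1}^n\frac{p_i}{|b_i|}\bigl(h(\varepsilon)+h(0)+\varepsilon\sup_{[0,\varepsilon]}|h'|\bigr)\biggr)^{k+1}.$$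
   Context: Setting. $I=[-1,1]$. The numbers $\lambda,a_k,b_k\in\mathbb{R}$ ($k=1,\dots,n$) satisfy $0<|\lambda|<1$, $b_k\neq 0$, and the maps $f_{k,t}(x)=\lambda x+a_k+b_k t$ satisfy $f_{k,t}(I)\subset I$ for all $0\le t\le\varepsilon$ and all $k$. The function $h:[0,\varepsilon]\to[0,\infty)$ is smooth with $\int_0^\varepsilon h(x)\,dx=1$. At each iterate, a map $f_{k,t}$ is applied, where $k$ is chosen with probability $p_k$ and $t$ is chosen with density $h$, independently of previous iterates. A probability measure $\mu$ on $I$ is invariant if $\mu(E)=\sum_{i=1}^n p_i\int_0^\varepsilon\mu(f_{i,t}^{-1}(E))\,h(t)\,dt$ for all measurable $E\subset I$. It is known (Diaconis and Freedman) that there is a unique invariant probability measure. $\mathcal{C}^\infty(I)$ is the set of infinitely differentiable functions on $I$. *)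

theory Defs
  imports "HOL-Probability.Probability"
begin

(* On a nondegenerate closed interval S these are the usual derivatives,
   one-sided at the two endpoints. *)
primrec nth_deriv_on :: "real set \<Rightarrow> nat \<Rightarrow> (real \<Rightarrow> real) \<Rightarrow> real \<Rightarrow> real" where
  "nth_deriv_on S 0 f = f"
| "nth_deriv_on S (Suc k) f = (\<lambda>x. vector_derivative (nth_deriv_on S k f) (at x within S))"

definition smooth_real_on :: "real set \<Rightarrow> (real \<Rightarrow> real) \<Rightarrow> bool" where
  "smooth_real_on S f \<longleftrightarrow> (\<forall>k. \<forall>x\<in>S. nth_deriv_on S k f differentiable (at x within S))"

definition rifs_map ::
    "real \<Rightarrow> (nat \<Rightarrow> real) \<Rightarrow> (nat \<Rightarrow> real) \<Rightarrow> nat \<Rightarrow> real \<Rightarrow> real \<Rightarrow> real" where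
  "rifs_map l a b k t x = l * x + a k + b k * t"

(* The maps are self-maps of [-1,1], hence the preimage is taken inside [-1,1];
   measurable subsets of [-1,1] are its Borel subsets. *)
definition invariant_prob ::
    "nat \<Rightarrow> real \<Rightarrow> (nat \<Rightarrow> real) \<Rightarrow> (nat \<Rightarrow> real) \<Rightarrow> (nat \<Rightarrow> real) \<Rightarrow> real \<Rightarrow> (real \<Rightarrow> real)
      \<Rightarrow> real measure \<Rightarrow> bool" where
  "invariant_prob n l a b p \<epsilon> h \<mu> \<longleftrightarrow>
     prob_space \<mu> \<and> space \<mu> = {-1..1} \<and> sets \<mu> = sets (restrict_space borel {-1..1}) \<and>
     (\<forall>E\<in>sets \<mu>. measure \<mu> E =
        (\<Sum>i=1..n. p i * (LBINT t:{0..\<epsilon>}. measure \<mu> (rifs_map l a b i t -` E \<inter> {-1..1}) * h t)))"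

end

(* Let S x be the mass of mu left of x minus the mass right of x (atoms at x cancel). Invariance
   of mu becomes the eigenfunction equation S = sgn l * K S, where K averages
   h t * S ((x - a k - b k * t) / l) over k and t; the symmetric choice of S makes this hold for
   both signs of l. Since S is monotone, it has countably many discontinuities and K S is continuous
   by dominated convergence. From then on the equation bootstraps: if g is continuous with
   g = c * K g, moving the x-derivative onto h by an integration by parts in t shows that g is C^1
   with sup |g'| <= |c| C sup |g|, C being the constant in the theorem, and g' = (c / l) * K g'.
   Iterating from |S| <= 1, the derivative of order k + 1 of S is bounded by
   |l| powr (- k (k + 1) / 2) * C ^ (k + 1), and the density of mu is S' / 2. *)
theory Submission
  imports Defs
begin

section \<open>Averaging along preimages and its derivatives\<close>

text \<open>For \<open>l \<noteq> 0\<close> the point \<open>(x - a - b * t) / l\<close> is the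
  preimage of \<open>x\<close> under the affine map with parameter \<open>t\<close>, so
  \<open>w = h\<close> gives the operator K for a single index. The weight stays general because
  integration by parts also produces the weight \<open>h'\<close>. The gauge integral is the one for
  which the Leibniz rule and the fundamental theorem of calculus are stated.\<close>

definition smear :: "(real \<Rightarrow> real) \<Rightarrow> real \<Rightarrow> real \<Rightarrow> real \<Rightarrow> real \<Rightarrow> (real \<Rightarrow> real) \<Rightarrow> real \<Rightarrow> real" where
  "smear w e l a b g x = integral {0..e} (\<lambda>t. w t * g ((x - a - b * t) / l))"

lemma continuous_on_affine_comp:
  fixes g :: "real \<Rightarrow> real"
  assumes "continuous_on UNIV g"
  shows "continuous_on A (\<lambda>t. g ((x - a - b * t) / l))"
\<comment> \<open>For \<open>l = 0\<close> the quotient is 0 by convention, so the function is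
  constant.\<close>
proof (cases "l = 0")
  case False
  then show ?thesis
    by (intro continuous_on_compose2[OF assms] continuous_intros) auto
qed simp

lemma continuous_on_smear:
  assumes "l \<noteq> 0" "continuous_on {0..e} w" "continuous_on UNIV g"
  shows "continuous_on UNIV (smear w e l a b g)"
proof -
  have "continuous_on UNIV (\<lambda>x. integral (cbox 0 e) (\<lambda>t. w t * g ((x - a - b * t) / l)))"
  proof (rule integral_continuous_on_param)
    show "continuous_on (UNIV \<times> cbox 0 e) (\<lambda>(x, t). w t * g ((x - a - b * t) / l))"
      unfolding case_prod_unfold
      by (intro continuous_intros continuous_on_compose2[OF assms(2)]
          continuous_on_compose2[OF assms(3)]) (use assms(1) in auto)
  qed
  then show ?thesis
    by (simp add: smear_def[abs_def])
qed

text \<open>Differentiation under the integral sign. The inner affine map contributes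
  \<open>1 / l\<close>, which is what divides the eigenvalue by \<open>l\<close> at each
  differentiation.\<close>

lemma has_real_derivative_smear:
  assumes "l \<noteq> 0" "continuous_on {0..e} w"
    and g: "\<And>x. (g has_real_derivative g' x) (at x)" and g': "continuous_on UNIV g'"
  shows "(smear w e l a b g has_real_derivative smear w e l a b g' x / l) (at x)"
proof -
  have contg: "continuous_on UNIV g"
    using g by (meson DERIV_isCont continuous_at_imp_continuous_on)
  have "((\<lambda>x. integral (cbox 0 e) (\<lambda>t. w t * g ((x - a - b * t) / l))) has_field_derivative
      integral (cbox 0 e) (\<lambda>t. w t * g' ((x - a - b * t) / l) / l)) (at x within UNIV)"
  proof (rule leibniz_rule_field_derivative)
    show "((\<lambda>x. w t * g ((x - a - b * t) / l)) has_field_derivative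
        w t * g' ((x - a - b * t) / l) / l) (at x within UNIV)" for x t
      using assms(1) by (auto intro!: derivative_eq_intros DERIV_chain2[OF g])
    show "(\<lambda>t. w t * g ((x - a - b * t) / l)) integrable_on cbox 0 e" for x
      by (intro integrable_continuous continuous_on_mult continuous_on_affine_comp contg)
        (use assms(2) in simp)
    show "continuous_on (UNIV \<times> cbox 0 e) (\<lambda>(x, t). w t * g' ((x - a - b * t) / l) / l)"
      unfolding case_prod_unfold
      by (intro continuous_intros continuous_on_compose2[OF assms(2)]
          continuous_on_compose2[OF g']) (use assms(1) in auto)
  qed auto
  then show ?thesis
    by (simp add: smear_def[abs_def])
qed

text \<open>The variables enter \<open>g\<close> only through \<open>x - b * t\<close>, so an
  \<open>x\<close>-derivative is \<open>- 1 / b\<close> times a \<open>t\<close>-derivative, and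
  integration by parts moves the latter onto \<open>h\<close>. The resulting formula contains
  \<open>g\<close> but not its derivative: averaging a continuous function gains one
  derivative.\<close>

lemma has_real_derivative_smear_by_parts:
  assumes "0 \<le> e" "l \<noteq> 0" "b \<noteq> 0" and g: "continuous_on UNIV g"
    and h: "\<And>t. t \<in> {0..e} \<Longrightarrow> (h has_real_derivative h' t) (at t within {0..e})"
    and h': "continuous_on {0..e} h'"
  shows "(smear h e l a b g has_real_derivative
    (h 0 * g ((x - a) / l) - h e * g ((x - a - b * e) / l) + smear h' e l a b g x) / b) (at x)"
proof -
  \<comment> \<open>The integration by parts is carried out with an antiderivative \<open>G\<close>,
    since \<open>g\<close> itself is only continuous.\<close>
  obtain G where G: "\<And>x. (G has_real_derivative g x) (at x)"
  proof -
    have "\<exists>F. \<forall>x::real. -\<infinity> < ereal x \<longrightarrow> ereal x < \<infinity> \<longrightarrow> (F has_vector_derivative g x) (at x)"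
      by (rule einterval_antiderivative) (use g in \<open>auto simp: continuous_on_eq_continuous_at\<close>)
    then show ?thesis
      using that by (auto simp: has_real_derivative_iff_has_vector_derivative)
  qed
  have contG: "continuous_on UNIV G"
    using G by (meson DERIV_isCont continuous_at_imp_continuous_on)
  have conth: "continuous_on {0..e} h"
    using h by (meson DERIV_continuous_on)
  \<comment> \<open>The \<open>t\<close>-derivative of \<open>h t * G ((x - a - b * t) / l)\<close>
    contains \<open>g\<close> with the inner factor \<open>- (b / l)\<close>; integrating it and
    solving for the term with \<open>g\<close> expresses the average through \<open>G\<close>
    alone.\<close>
  have eq: "smear h e l a b g x =
      (l / b) * (h 0 * G ((x - a) / l) - h e * G ((x - a - b * e) / l) + smear h' e l a b G x)" for x
  proof -
    let ?z = "\<lambda>t. (x - a - b * t) / l"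
    have "((\<lambda>t. h t * (- (b / l) * g (?z t)) + h' t * G (?z t)) has_integral
        h e * G (?z e) - h 0 * G (?z 0)) {0..e}"
    proof (rule fundamental_theorem_of_calculus[OF assms(1)])
      fix t assume "t \<in> {0..e}"
      have "((\<lambda>t. h t * G (?z t)) has_real_derivative
          h t * (- (b / l) * g (?z t)) + h' t * G (?z t)) (at t within {0..e})"
        using assms(2) h[OF \<open>t \<in> {0..e}\<close>]
        by (auto intro!: derivative_eq_intros DERIV_chain2[OF G] simp: field_simps)
      then show "((\<lambda>t. h t * G (?z t)) has_vector_derivative
          h t * (- (b / l) * g (?z t)) + h' t * G (?z t)) (at t within {0..e})"
        by (simp add: has_real_derivative_iff_has_vector_derivative)
    qed
    moreover have "((\<lambda>t. h' t * G (?z t)) has_integral smear h' e l a b G x) {0..e}"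
      unfolding smear_def
      by (intro integrable_integral integrable_continuous_interval continuous_on_mult h'
          continuous_on_affine_comp contG)
    ultimately have "((\<lambda>t. - (b / l) * (h t * g (?z t))) has_integral
        h e * G (?z e) - h 0 * G (?z 0) - smear h' e l a b G x) {0..e}"
      by (rule has_integral_eq_rhs[OF has_integral_eq[rotated, OF has_integral_diff]])
        (simp_all add: algebra_simps)
    moreover have "((\<lambda>t. h t * g (?z t)) has_integral smear h e l a b g x) {0..e}"
      unfolding smear_def
      by (intro integrable_integral integrable_continuous_interval continuous_on_mult conth
          continuous_on_affine_comp g)
    then have "((\<lambda>t. - (b / l) * (h t * g (?z t))) has_integral - (b / l) * smear h e l a b g x) {0..e}"
      by (rule has_integral_mult_right)
    ultimately have "- (b / l) * smear h e l a b g x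
        = h e * G (?z e) - h 0 * G (?z 0) - smear h' e l a b G x"
      by (blast intro: has_integral_unique)
    then show ?thesis
      using assms(2,3) by (simp add: field_simps)
  qed
  \<comment> \<open>All terms with \<open>G\<close> are differentiable in \<open>x\<close>. Their
    inner factors \<open>1 / l\<close> cancel the prefactor \<open>l\<close>, which leaves
    \<open>1 / b\<close>.\<close>
  show ?thesis
    unfolding eq[abs_def]
    using assms(2,3)
    by (auto intro!: derivative_eq_intros DERIV_chain2[OF G]
        has_real_derivative_smear[OF assms(2) h' G g] simp: field_simps)
qed

lemma smear_abs_le:
  assumes "0 \<le> e" "l \<noteq> 0" "continuous_on {0..e} w" "continuous_on UNIV g"
    and "\<And>t. t \<in> {0..e} \<Longrightarrow> \<bar>w t\<bar> \<le> M" and "\<And>y. \<bar>g y\<bar> \<le> B"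
  shows "\<bar>smear w e l a b g x\<bar> \<le> e * M * B"
proof -
  have "norm (integral {0..e} (\<lambda>t. w t * g ((x - a - b * t) / l))) \<le> (M * B) * (e - 0)"
  proof (rule integral_bound[OF assms(1)])
    show "continuous_on {0..e} (\<lambda>t. w t * g ((x - a - b * t) / l))"
      by (intro continuous_on_mult assms(3) continuous_on_affine_comp assms(4))
    show "norm (w t * g ((x - a - b * t) / l)) \<le> M * B" if "t \<in> {0..e}" for t
      using mult_mono[OF assms(5)[OF that] assms(6)] assms(5)[OF that]
      by (auto simp: abs_mult intro: order_trans[OF abs_ge_zero])
  qed
  then show ?thesis
    by (simp add: smear_def mult_ac)
qed

text \<open>One round of the bootstrap. Differentiating the equation by parts shows that
  \<open>g\<close> is C^1 and gives the bound; differentiating it under the integral gives the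
  equation for \<open>deriv g\<close> with \<open>c / l\<close> in place of \<open>c\<close>.
  Continuity, bound and equation thus pass from \<open>g\<close> to \<open>deriv g\<close>, and the
  lemma can be iterated.\<close>

lemma smear_eigenfunction_deriv:
  fixes n :: nat and a b p :: "nat \<Rightarrow> real"
  assumes "0 \<le> e" "l \<noteq> 0" and b: "\<And>k. k \<in> {1..n} \<Longrightarrow> b k \<noteq> 0"
    and p: "\<And>k. k \<in> {1..n} \<Longrightarrow> 0 \<le> p k"
    and h: "\<And>t. t \<in> {0..e} \<Longrightarrow> (h has_real_derivative h' t) (at t within {0..e})"
    and h': "continuous_on {0..e} h'" and M: "\<And>t. t \<in> {0..e} \<Longrightarrow> \<bar>h' t\<bar> \<le> M"
    and hpos: "0 \<le> h 0" "0 \<le> h e"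
    and g: "continuous_on UNIV g" and B: "\<And>x. \<bar>g x\<bar> \<le> B"
    and eig: "\<And>x. g x = c * (\<Sum>k=1..n. p k * smear h e l (a k) (b k) g x)"
  shows "(g has_real_derivative deriv g x) (at x)"
    and "continuous_on UNIV (deriv g)"
    and "deriv g x = c / l * (\<Sum>k=1..n. p k * smear h e l (a k) (b k) (deriv g) x)"
    and "\<bar>deriv g x\<bar> \<le> \<bar>c\<bar> * (\<Sum>k=1..n. p k / \<bar>b k\<bar> * (h e + h 0 + e * M)) * B"
proof -
  define D where "D k x = (h 0 * g ((x - a k) / l) - h e * g ((x - a k - b k * e) / l)
      + smear h' e l (a k) (b k) g x) / b k" for k x
  define d where "d x = c * (\<Sum>k=1..n. p k * D k x)" for x
  have D: "(smear h e l (a k) (b k) g has_real_derivative D k x) (at x)" if "k \<in> {1..n}" for k x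
    unfolding D_def by (rule has_real_derivative_smear_by_parts[OF assms(1,2) b[OF that] g h h'])
  have eig_fun: "(\<lambda>x. c * (\<Sum>k=1..n. p k * smear h e l (a k) (b k) g x)) = g"
    by (rule ext) (rule eig[symmetric])
  have der: "(g has_real_derivative d x) (at x)" for x
  proof -
    have "((\<lambda>x. c * (\<Sum>k=1..n. p k * smear h e l (a k) (b k) g x)) has_real_derivative d x) (at x)"
      unfolding d_def by (intro DERIV_cmult DERIV_sum D)
    then show ?thesis
      unfolding eig_fun .
  qed
  then have deriv: "deriv g = d"
    by (auto intro: DERIV_imp_deriv)
  have contd: "continuous_on UNIV d"
    unfolding d_def D_def
    by (intro continuous_intros continuous_on_smear h' g continuous_on_compose2[OF g])
      (use assms(2) b in auto)
  show "(g has_real_derivative deriv g x) (at x)" "continuous_on UNIV (deriv g)"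
    using der contd deriv by auto
  have conth: "continuous_on {0..e} h"
    using h by (meson DERIV_continuous_on)
  \<comment> \<open>Now that \<open>g\<close> is known to be C^1, the same sum is differentiated by
    the Leibniz rule as well; uniqueness of derivatives equates the two results.\<close>
  have "((\<lambda>x. c * (\<Sum>k=1..n. p k * smear h e l (a k) (b k) g x)) has_real_derivative
      c * (\<Sum>k=1..n. p k * (smear h e l (a k) (b k) d x / l))) (at x)"
    by (intro DERIV_cmult DERIV_sum has_real_derivative_smear assms(2) conth der contd)
  then have "d x = c * (\<Sum>k=1..n. p k * (smear h e l (a k) (b k) d x / l))"
    unfolding eig_fun by (rule DERIV_unique[OF der])
  then show "deriv g x = c / l * (\<Sum>k=1..n. p k * smear h e l (a k) (b k) (deriv g) x)"
    by (simp add: deriv sum_divide_distrib[symmetric])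
  \<comment> \<open>The boundary terms contribute \<open>h 0\<close> and \<open>h e\<close>, and the
    integral against \<open>h'\<close> contributes \<open>e * M\<close>.\<close>
  have Dle: "\<bar>D k x\<bar> \<le> (h e + h 0 + e * M) * B / \<bar>b k\<bar>" if "k \<in> {1..n}" for k
  proof -
    have "\<bar>h 0 * g ((x - a k) / l)\<bar> \<le> h 0 * B" "\<bar>h e * g ((x - a k - b k * e) / l)\<bar> \<le> h e * B"
      using hpos by (auto simp: abs_mult intro!: mult_left_mono B)
    moreover have "\<bar>smear h' e l (a k) (b k) g x\<bar> \<le> e * M * B"
      by (rule smear_abs_le[OF assms(1,2) h' g M B])
    ultimately have "\<bar>h 0 * g ((x - a k) / l) - h e * g ((x - a k - b k * e) / l)
      + smear h' e l (a k) (b k) g x\<bar> \<le> (h e + h 0 + e * M) * B"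
      by (simp add: algebra_simps)
    then show ?thesis
      by (simp add: D_def divide_right_mono)
  qed
  have "\<bar>\<Sum>k=1..n. p k * D k x\<bar> \<le> (\<Sum>k=1..n. p k * ((h e + h 0 + e * M) * B / \<bar>b k\<bar>))"
  proof (intro order_trans[OF sum_abs] sum_mono)
    fix k assume k: "k \<in> {1..n}"
    show "\<bar>p k * D k x\<bar> \<le> p k * ((h e + h 0 + e * M) * B / \<bar>b k\<bar>)"
      using mult_left_mono[OF Dle[OF k] p[OF k]] p[OF k] by (simp add: abs_mult)
  qed
  also have "\<dots> = (\<Sum>k=1..n. p k / \<bar>b k\<bar> * (h e + h 0 + e * M)) * B"
    unfolding sum_distrib_right by (intro sum.cong refl) (simp add: mult_ac)
  finally show "\<bar>deriv g x\<bar> \<le> \<bar>c\<bar> * (\<Sum>k=1..n. p k / \<bar>b k\<bar> * (h e + h 0 + e * M)) * B"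
    by (simp add: deriv d_def abs_mult mult.assoc mult_left_mono)
qed

section \<open>Iterated one-sided derivatives on an interval\<close>

text \<open>Derivatives on the whole line restrict to one-sided ones at the endpoints, and
  \<open>u < v\<close> makes derivatives within the interval unique. The induction has to transform
  the function, because \<open>nth_deriv_on\<close> is known to agree with \<open>D k\<close> only
  on the interval.\<close>

lemma nth_deriv_on_eq:
  assumes "\<And>k x. (D k has_real_derivative D (Suc k) x) (at x)" "u < v" "x \<in> {u..v}"
  shows "nth_deriv_on {u..v} k (D 0) x = D k x"
  using assms(3)
proof (induction k arbitrary: x)
  case (Suc k)
  have "(nth_deriv_on {u..v} k (D 0) has_vector_derivative D (Suc k) x) (at x within {u..v})"
  proof (rule has_vector_derivative_transform)
    show "(D k has_vector_derivative D (Suc k) x) (at x within {u..v})"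
      using assms(1)[of k x] by (auto simp: has_real_derivative_iff_has_vector_derivative
          intro: has_vector_derivative_at_within)
  qed (use Suc in auto)
  then show ?case
    using assms(2) Suc.prems vector_derivative_within_cbox[of u v x] by simp
qed simp

lemma smooth_real_on_deriv_sequence:
  assumes "\<And>k x. (D k has_real_derivative D (Suc k) x) (at x)" "u < v"
  shows "smooth_real_on {u..v} (D 0)"
  unfolding smooth_real_on_def
proof (intro allI ballI)
  fix k x assume x: "x \<in> {u..v}"
  have "D k differentiable (at x within {u..v})"
    using assms(1) by (meson real_differentiable_def differentiable_at_withinI)
  then show "nth_deriv_on {u..v} k (D 0) differentiable (at x within {u..v})"
    by (rule differentiable_transform_within[where d=1]) (use nth_deriv_on_eq[of D, OF assms] x in auto)
qed


section \<open>Averages of bounded monotone functions\<close>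

lemma set_integrable_bounded_mult:
  fixes f w :: "real \<Rightarrow> real"
  assumes "continuous_on {u..v} w" "f \<in> borel_measurable borel" "\<And>y. \<bar>f y\<bar> \<le> B"
  shows "set_integrable lborel {u..v} (\<lambda>t. w t * f t)"
proof (rule set_integrable_bound)
  have w: "set_integrable lborel {u..v} w"
    by (rule borel_integrable_atLeastAtMost') (rule assms(1))
  then show "set_integrable lborel {u..v} (\<lambda>t. w t * B)"
    by simp
  have "(\<lambda>t. (indicator {u..v} t *\<^sub>R w t) * f t) \<in> borel_measurable lborel"
    using borel_measurable_integrable[OF w[unfolded set_integrable_def]] assms(2) by measurable
  then show "set_borel_measurable lborel {u..v} (\<lambda>t. w t * f t)"
    by (simp add: set_borel_measurable_def mult.assoc)
  show "AE t in lborel. t \<in> {u..v} \<longrightarrow> norm (w t * f t) \<le> norm (w t * B)"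
    using assms(3) order_trans[OF abs_ge_zero assms(3)]
    by (auto simp: abs_mult intro!: mult_left_mono)
qed

text \<open>Passage from the gauge integral to the Lebesgue integral, in which invariance is stated
  and dominated convergence is available.\<close>

lemma smear_eq_set_integral:
  assumes "continuous_on {0..e} w" "g \<in> borel_measurable borel" "\<And>y. \<bar>g y\<bar> \<le> B"
  shows "smear w e l a b g x = (LBINT t:{0..e}. w t * g ((x - a - b * t) / l))"
  unfolding smear_def
  by (rule set_borel_integral_eq_integral(2)[symmetric], rule set_integrable_bounded_mult)
    (use assms in auto)

text \<open>A monotone function has countably many discontinuities, so for a fixed limit point
  \<open>x0\<close> the integrands converge for all but countably many \<open>t\<close>. Dominated
  convergence then gives sequential continuity.\<close>

lemma continuous_on_smear_mono:
  assumes "l \<noteq> 0" "b \<noteq> 0" "continuous_on {0..e} w" "mono g" and B: "\<And>y. \<bar>g y\<bar> \<le> B"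
  shows "continuous_on UNIV (smear w e l a b g)"
  unfolding continuous_on_sequentially
proof (intro allI ballI impI)
  fix x and x0 :: real
  assume "(\<forall>n. x n \<in> UNIV) \<and> x \<longlonglongrightarrow> x0"
  then have x: "x \<longlonglongrightarrow> x0" by simp
  have g[measurable]: "g \<in> borel_measurable borel"
    by (rule borel_measurable_mono) (rule assms(4))
  let ?f = "\<lambda>x t. indicator {0..e} t *\<^sub>R (w t * g ((x - a - b * t) / l))"
  let ?w = "\<lambda>t. indicator {0..e} t *\<^sub>R (\<bar>w t\<bar> * B)"
  have int: "set_integrable lborel {0..e} (\<lambda>t. w t * g ((x - a - b * t) / l))" for x
    by (rule set_integrable_bounded_mult[OF assms(3)]) (use B in auto)
  \<comment> \<open>Since \<open>b \<noteq> 0\<close>, the parameter \<open>t\<close> can be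
    recovered from the point where \<open>g\<close> is evaluated. The exceptional parameters
    therefore lie in an affine image of the discontinuity set of \<open>g\<close>.\<close>
  define N where "N = {t. \<not> isCont g ((x0 - a - b * t) / l)}"
  have "N \<subseteq> (\<lambda>y. (x0 - a - l * y) / b) ` {y. \<not> isCont g y}"
  proof
    fix t assume "t \<in> N"
    moreover have "t = (x0 - a - l * ((x0 - a - b * t) / l)) / b"
      using assms(1,2) by simp
    ultimately show "t \<in> (\<lambda>y. (x0 - a - l * y) / b) ` {y. \<not> isCont g y}"
      unfolding N_def by blast
  qed
  then have "countable N"
    using mono_ctble_discont[OF assms(4)] by (meson countable_image countable_subset)
  then have ae: "AE t in lborel. t \<notin> N"
    by (intro AE_not_in countable_imp_null_set_lborel)
  have "(\<lambda>n. integral\<^sup>L lborel (?f (x n))) \<longlonglongrightarrow> integral\<^sup>L lborel (?f x0)"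
  proof (rule integral_dominated_convergence[where w = ?w])
    show "?f x0 \<in> borel_measurable lborel" "?f (x n) \<in> borel_measurable lborel" for n
      using int unfolding set_integrable_def by (auto dest: borel_measurable_integrable)
    have "set_integrable lborel {0..e} (\<lambda>t. \<bar>w t\<bar> * B)"
      by (intro borel_integrable_atLeastAtMost' continuous_intros assms(3))
    then show "integrable lborel ?w"
      by (simp add: set_integrable_def)
    show "AE t in lborel. (\<lambda>n. ?f (x n) t) \<longlonglongrightarrow> ?f x0 t"
      using ae
    proof eventually_elim
      case (elim t)
      then have "isCont g ((x0 - a - b * t) / l)"
        by (simp add: N_def)
      moreover have "(\<lambda>n. (x n - a - b * t) / l) \<longlonglongrightarrow> (x0 - a - b * t) / l"
        by (intro tendsto_intros x assms(1))
      ultimately have "(\<lambda>n. g ((x n - a - b * t) / l)) \<longlonglongrightarrow> g ((x0 - a - b * t) / l)"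
        by (rule isCont_tendsto_compose)
      then show ?case
        by (intro tendsto_intros)
    qed
    show "AE t in lborel. norm (?f (x n) t) \<le> ?w t" for n
      by (auto simp: abs_mult indicator_def intro!: mult_left_mono B)
  qed
  then show "(smear w e l a b g \<circ> x) \<longlonglongrightarrow> smear w e l a b g x0"
    unfolding comp_def smear_eq_set_integral[OF assms(3) g B] set_lebesgue_integral_def .
qed

section \<open>Centered distribution function of an invariant measure\<close>

text \<open>Both closed tails contain \<open>x\<close>, so an atom at \<open>x\<close> cancels. A
  decreasing affine map exchanges the tails and only changes the sign, whereas the usual
  distribution function would turn into one minus its left limit. Intersecting with the space keeps
  the tails measurable for every real \<open>x\<close>.\<close>

definition centered_cdf :: "real measure \<Rightarrow> real \<Rightarrow> real" where
  "centered_cdf \<mu> x = measure \<mu> ({..x} \<inter> space \<mu>) - measure \<mu> ({x..} \<inter> space \<mu>)"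

context
  fixes \<mu> :: "real measure"
  assumes prob: "prob_space \<mu>" and space: "space \<mu> = {-1..1}"
    and sets: "sets \<mu> = sets (restrict_space borel {-1..1})"
begin

interpretation prob_space \<mu> by (rule prob)

lemma sets_iff: "E \<in> sets \<mu> \<longleftrightarrow> E \<in> sets borel \<and> E \<subseteq> {-1..1}"
  unfolding sets by (subst sets_restrict_space_iff) auto

lemma Int_in_sets: "A \<in> sets borel \<Longrightarrow> A \<inter> space \<mu> \<in> sets \<mu>"
  by (simp add: sets_iff space)

lemma mono_measure_atMost: "mono (\<lambda>x. measure \<mu> ({..x} \<inter> space \<mu>))"
  by (intro monoI finite_measure_mono Int_in_sets) auto

lemma antimono_measure_atLeast: "antimono (\<lambda>x. measure \<mu> ({x..} \<inter> space \<mu>))"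
  by (intro antimonoI finite_measure_mono Int_in_sets) auto

lemma borel_measure_atMost[measurable]:
  "(\<lambda>x. measure \<mu> ({..x} \<inter> space \<mu>)) \<in> borel_measurable borel"
  by (rule borel_measurable_mono) (rule mono_measure_atMost)

lemma borel_measure_atLeast[measurable]:
  "(\<lambda>x. measure \<mu> ({x..} \<inter> space \<mu>)) \<in> borel_measurable borel"
proof -
  have "(\<lambda>x. - measure \<mu> ({x..} \<inter> space \<mu>)) \<in> borel_measurable borel"
    by (rule borel_measurable_mono) (use antimono_measure_atLeast in \<open>auto simp: monotone_def\<close>)
  then show ?thesis by simp
qed

lemma mono_centered_cdf: "mono (centered_cdf \<mu>)"
  using mono_measure_atMost antimono_measure_atLeast
  unfolding centered_cdf_def monotone_def by (metis diff_mono)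

lemma abs_centered_cdf_le: "\<bar>centered_cdf \<mu> x\<bar> \<le> 1"
  using prob_le_1[of "{..x} \<inter> space \<mu>"] prob_le_1[of "{x..} \<inter> space \<mu>"]
    measure_nonneg[of \<mu> "{..x} \<inter> space \<mu>"] measure_nonneg[of \<mu> "{x..} \<inter> space \<mu>"]
  unfolding centered_cdf_def by linarith

text \<open>The preimage of a closed half-line is the closed half-line ending at the preimage of
  \<open>x\<close>, on the same side for \<open>l > 0\<close> and on the opposite side for
  \<open>l < 0\<close>. Subtracting the invariance equations of the two tails turns this into the
  factor \<open>sgn l\<close>.\<close>

lemma centered_cdf_invariant:
  assumes l: "l \<noteq> 0" and h: "continuous_on {0..e} h"
    and maps: "\<And>k t. k \<in> {1..n} \<Longrightarrow> 0 \<le> t \<Longrightarrow> t \<le> e \<Longrightarrow> rifs_map l a b k t ` {-1..1} \<subseteq> {-1..1}"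
    and inv: "invariant_prob n l a b p e h \<mu>"
  shows "centered_cdf \<mu> x = sgn l * (\<Sum>k=1..n. p k * smear h e l (a k) (b k) (centered_cdf \<mu>) x)"
proof -
  let ?S = "centered_cdf \<mu>"
  define L where "L z = measure \<mu> ({..z} \<inter> space \<mu>)" for z
  define R where "R z = measure \<mu> ({z..} \<inter> space \<mu>)" for z
  let ?z = "\<lambda>k t. (x - a k - b k * t) / l"
  let ?m = "\<lambda>E k t. measure \<mu> (rifs_map l a b k t -` E \<inter> {-1..1})"
  have [measurable]: "L \<in> borel_measurable borel" "R \<in> borel_measurable borel"
    unfolding L_def R_def by measurable
  have S: "?S = (\<lambda>z. L z - R z)"
    by (auto simp: centered_cdf_def L_def R_def)
  have measS: "?S \<in> borel_measurable borel"
    unfolding S by measurable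
  have int: "set_integrable lborel {0..e} (\<lambda>t. h t * L (?z k t))"
    "set_integrable lborel {0..e} (\<lambda>t. h t * R (?z k t))" for k
    by (rule set_integrable_bounded_mult[OF h, where B=1]; simp add: L_def R_def)+
  have pre: "?m ({..x} \<inter> space \<mu>) k t = (if 0 < l then L (?z k t) else R (?z k t))"
    "?m ({x..} \<inter> space \<mu>) k t = (if 0 < l then R (?z k t) else L (?z k t))"
    if k: "k \<in> {1..n}" and t: "t \<in> {0..e}" for k t
  proof -
    have le: "rifs_map l a b k t y \<le> x \<longleftrightarrow> (if 0 < l then y \<le> ?z k t else ?z k t \<le> y)"
      "x \<le> rifs_map l a b k t y \<longleftrightarrow> (if 0 < l then ?z k t \<le> y else y \<le> ?z k t)" for y
      using l by (auto simp: rifs_map_def field_simps split: if_splits)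
    \<comment> \<open>The maps preserve the interval, so cutting a tail down to the space does not
      change its preimage inside the interval.\<close>
    have in_space: "rifs_map l a b k t y \<in> space \<mu>" if "y \<in> space \<mu>" for y
    proof -
      have "0 \<le> t" "t \<le> e" using t by auto
      from maps[OF k this] that show ?thesis unfolding space by blast
    qed
    show "?m ({..x} \<inter> space \<mu>) k t = (if 0 < l then L (?z k t) else R (?z k t))"
      "?m ({x..} \<inter> space \<mu>) k t = (if 0 < l then R (?z k t) else L (?z k t))"
      unfolding space[symmetric] L_def R_def using in_space
      by (auto simp: le intro!: arg_cong[where f="measure \<mu>"])
  qed
  have term_eq: "(LBINT t:{0..e}. ?m ({..x} \<inter> space \<mu>) k t * h t)
      - (LBINT t:{0..e}. ?m ({x..} \<inter> space \<mu>) k t * h t)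
      = sgn l * smear h e l (a k) (b k) ?S x" if k: "k \<in> {1..n}" for k
  proof -
    let ?L = "LBINT t:{0..e}. h t * L (?z k t)" and ?R = "LBINT t:{0..e}. h t * R (?z k t)"
    have "smear h e l (a k) (b k) ?S x = (LBINT t:{0..e}. h t * L (?z k t) - h t * R (?z k t))"
      unfolding smear_eq_set_integral[OF h measS abs_centered_cdf_le]
      by (simp add: S right_diff_distrib)
    also have "\<dots> = ?L - ?R"
      by (rule set_integral_diff(2)[OF int])
    finally have sm: "smear h e l (a k) (b k) ?S x = ?L - ?R" .
    have "(LBINT t:{0..e}. ?m ({..x} \<inter> space \<mu>) k t * h t) = (if 0 < l then ?L else ?R)"
      "(LBINT t:{0..e}. ?m ({x..} \<inter> space \<mu>) k t * h t) = (if 0 < l then ?R else ?L)"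
      using pre[OF k] by (auto intro!: set_lebesgue_integral_cong simp: mult.commute)
    then show ?thesis
      using l by (simp add: sm sgn_if)
  qed
  have "?S x = measure \<mu> ({..x} \<inter> space \<mu>) - measure \<mu> ({x..} \<inter> space \<mu>)"
    by (simp add: centered_cdf_def)
  also have "\<dots> = (\<Sum>k=1..n. p k * (LBINT t:{0..e}. ?m ({..x} \<inter> space \<mu>) k t * h t))
      - (\<Sum>k=1..n. p k * (LBINT t:{0..e}. ?m ({x..} \<inter> space \<mu>) k t * h t))"
    using inv Int_in_sets[of "{..x}"] Int_in_sets[of "{x..}"] unfolding invariant_prob_def by simp
  also have "\<dots> = (\<Sum>k=1..n. p k * ((LBINT t:{0..e}. ?m ({..x} \<inter> space \<mu>) k t * h t)
      - (LBINT t:{0..e}. ?m ({x..} \<inter> space \<mu>) k t * h t)))"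
    by (simp add: sum_subtractf right_diff_distrib)
  also have "\<dots> = (\<Sum>k=1..n. p k * (sgn l * smear h e l (a k) (b k) ?S x))"
    by (intro sum.cong refl) (simp only: term_eq)
  finally show ?thesis
    by (simp add: sum_distrib_left mult_ac)
qed

text \<open>As the argument passes an atom, the atom enters the left tail and leaves the right tail,
  so the centered function rises by at least twice its mass. Continuity rules this out.\<close>

lemma measure_singleton_eq_0:
  assumes "continuous_on UNIV (centered_cdf \<mu>)"
  shows "measure \<mu> ({x} \<inter> space \<mu>) = 0"
proof -
  let ?S = "centered_cdf \<mu>"
  have le: "2 * measure \<mu> ({x} \<inter> space \<mu>) \<le> ?S (x + d) - ?S (x - d)" if "0 < d" for d
  proof -
    have "measure \<mu> ({..x - d} \<inter> space \<mu>) + measure \<mu> ({x} \<inter> space \<mu>)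
        = measure \<mu> (({..x - d} \<inter> space \<mu>) \<union> ({x} \<inter> space \<mu>))"
      using that by (intro finite_measure_Union[symmetric] Int_in_sets) auto
    also have "\<dots> \<le> measure \<mu> ({..x + d} \<inter> space \<mu>)"
      using that by (intro finite_measure_mono Int_in_sets) auto
    finally have 1: "measure \<mu> ({..x - d} \<inter> space \<mu>) + measure \<mu> ({x} \<inter> space \<mu>)
      \<le> measure \<mu> ({..x + d} \<inter> space \<mu>)" .
    have "measure \<mu> ({x + d..} \<inter> space \<mu>) + measure \<mu> ({x} \<inter> space \<mu>)
        = measure \<mu> (({x + d..} \<inter> space \<mu>) \<union> ({x} \<inter> space \<mu>))"
      using that by (intro finite_measure_Union[symmetric] Int_in_sets) auto
    also have "\<dots> \<le> measure \<mu> ({x - d..} \<inter> space \<mu>)"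
      using that by (intro finite_measure_mono Int_in_sets) auto
    finally show ?thesis
      using 1 by (simp add: centered_cdf_def)
  qed
  have "isCont ?S x"
    using assms by (simp add: continuous_on_eq_continuous_at)
  \<comment> \<open>The inequality \<open>le\<close> is used with \<open>d = 1 / (n + 1)\<close>,
    and its right-hand side tends to 0.\<close>
  moreover have "(\<lambda>n. x + inverse (real (Suc n))) \<longlonglongrightarrow> x + 0"
    "(\<lambda>n. x - inverse (real (Suc n))) \<longlonglongrightarrow> x - 0"
    by (intro tendsto_intros LIMSEQ_inverse_real_of_nat)+
  ultimately have "(\<lambda>n. ?S (x + inverse (real (Suc n))) - ?S (x - inverse (real (Suc n))))
      \<longlonglongrightarrow> ?S x - ?S x"
    by (intro tendsto_diff) (auto intro: isCont_tendsto_compose)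
  then have "2 * measure \<mu> ({x} \<inter> space \<mu>) \<le> ?S x - ?S x"
    by (rule LIMSEQ_le_const) (intro exI allI impI le, simp)
  then show ?thesis
    using measure_nonneg[of \<mu> "{x} \<inter> space \<mu>"] by simp
qed

text \<open>Without atoms the right tail has mass 1 - F, where F is the distribution function, so
  the centered function is 2 F - 1.\<close>

lemma measure_atMost_eq_centered_cdf:
  assumes "continuous_on UNIV (centered_cdf \<mu>)"
  shows "measure \<mu> ({..x} \<inter> space \<mu>) = (1 + centered_cdf \<mu> x) / 2"
proof -
  have "measure \<mu> ({..x} \<inter> space \<mu>) + measure \<mu> ({x<..} \<inter> space \<mu>)
      = measure \<mu> (({..x} \<inter> space \<mu>) \<union> ({x<..} \<inter> space \<mu>))"
    by (intro finite_measure_Union[symmetric] Int_in_sets) auto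
  also have "({..x} \<inter> space \<mu>) \<union> ({x<..} \<inter> space \<mu>) = space \<mu>"
    by auto
  finally have 1: "measure \<mu> ({..x} \<inter> space \<mu>) + measure \<mu> ({x<..} \<inter> space \<mu>) = 1"
    by (simp add: prob_space)
  have "measure \<mu> ({x<..} \<inter> space \<mu>) + measure \<mu> ({x} \<inter> space \<mu>)
      = measure \<mu> (({x<..} \<inter> space \<mu>) \<union> ({x} \<inter> space \<mu>))"
    by (intro finite_measure_Union[symmetric] Int_in_sets) auto
  also have "({x<..} \<inter> space \<mu>) \<union> ({x} \<inter> space \<mu>) = {x..} \<inter> space \<mu>"
    by auto
  finally show ?thesis
    using 1 measure_singleton_eq_0[OF assms, of x] by (simp add: centered_cdf_def)
qed

section \<open>From the derivative to a density\<close>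

text \<open>Monotonicity makes \<open>s\<close> nonnegative. By the fundamental theorem of calculus
  the measure with density \<open>s / 2\<close> has the same distribution function as
  \<open>\<mu>\<close>, and a distribution function determines its measure.\<close>

lemma density_of_deriv_centered_cdf:
  assumes der: "\<And>x. (centered_cdf \<mu> has_real_derivative s x) (at x)" and s: "continuous_on UNIV s"
  shows "\<And>x. 0 \<le> s x"
    and "\<mu> = density (restrict_space lborel {-1..1}) (\<lambda>x. ennreal (s x / 2))"
proof -
  let ?S = "centered_cdf \<mu>"
  show s0: "0 \<le> s x" for x
    by (rule mono_on_imp_deriv_nonneg[OF _ der, of UNIV]) (use mono_centered_cdf in auto)
  have contS: "continuous_on UNIV ?S"
    using der by (meson DERIV_isCont continuous_at_imp_continuous_on)
  note F = measure_atMost_eq_centered_cdf[OF contS]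
  have [measurable]: "s \<in> borel_measurable borel"
    by (rule borel_measurable_continuous_onI) (rule s)
  \<comment> \<open>Uniqueness from distribution functions concerns Borel measures on the line, so
    \<open>\<mu>\<close> is pushed forward along the inclusion and the candidate density is extended
    by zero.\<close>
  define M1 where "M1 = distr \<mu> borel (\<lambda>x. x)"
  define M2 where "M2 = density lborel (\<lambda>x. ennreal (s x / 2) * indicator {-1..1} x)"
  have id[measurable]: "(\<lambda>x. x) \<in> measurable \<mu> borel"
    unfolding measurable_cong_sets[OF sets refl] by (rule measurable_restrict_space1) simp
  have FTC: "(\<integral>\<^sup>+x. ennreal (s x / 2) * indicator {-1..v} x \<partial>lborel) = ennreal (?S v / 2 - ?S (-1) / 2)"
    if "-1 \<le> v" for v
    by (rule nn_integral_FTC_Icc) (use that s0 der in \<open>auto intro!: derivative_eq_intros\<close>)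
  \<comment> \<open>The endpoint -1 is no atom, so the distribution function vanishes there. The
    values of the centered function at -1 and 1 then give the candidate total mass 1.\<close>
  have "{..-1} \<inter> space \<mu> = {-1} \<inter> space \<mu>"
    by (auto simp: space)
  then have Sm1: "?S (-1) = -1"
    using F[of "-1"] measure_singleton_eq_0[OF contS, of "-1"] by simp
  have "{..1} \<inter> space \<mu> = space \<mu>"
    by (auto simp: space)
  then have S1: "?S 1 = 1"
    using F[of 1] by (simp add: prob_space)
  have "emeasure M2 (space M2) = 1"
    unfolding M2_def using FTC[of 1] by (simp add: emeasure_density Sm1 S1)
  then interpret M2: prob_space M2
    by (rule prob_spaceI)
  have "sets M2 = sets borel"
    by (simp add: M2_def)
  then interpret M2: real_distribution M2
    by unfold_locales
  interpret M1: real_distribution M1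
    unfolding M1_def by (intro real_distribution_distr id)
  have "cdf M1 x = cdf M2 x" for x
  proof -
    have cdf1: "cdf M1 x = measure \<mu> ({..x} \<inter> space \<mu>)"
      by (simp add: cdf_def M1_def measure_distr)
    have cdf2: "emeasure M2 {..x} = (\<integral>\<^sup>+y. ennreal (s y / 2) * indicator {-1..min x 1} y \<partial>lborel)"
      unfolding M2_def by (auto simp: emeasure_density indicator_def intro!: nn_integral_cong)
    \<comment> \<open>Left of the interval both distribution functions are 0, right of it both are
      1, and in between \<open>FTC\<close> applies.\<close>
    consider "x < -1" | "-1 \<le> x" "x \<le> 1" | "1 < x" by linarith
    then show ?thesis
    proof cases
      case 1
      then have "{..x} \<inter> space \<mu> = {}" "{-1..min x 1} = {}"
        by (auto simp: space)
      then show ?thesis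
        unfolding cdf1 using cdf2 by (simp add: cdf_def measure_def)
    next
      case 2
      have "emeasure M2 {..x} = ennreal (measure \<mu> ({..x} \<inter> space \<mu>))"
        using cdf2 FTC[of x] 2 by (simp add: F Sm1 min_def field_simps)
      then show ?thesis
        unfolding cdf1 by (simp add: cdf_def measure_def)
    next
      case 3
      then have "{..x} \<inter> space \<mu> = space \<mu>"
        by (auto simp: space)
      moreover have "emeasure M2 {..x} = 1"
        using cdf2 FTC[of 1] 3 by (simp add: min_def Sm1 S1)
      ultimately show ?thesis
        unfolding cdf1 by (simp add: cdf_def measure_def[of M2] prob_space)
    qed
  qed
  then have M12: "M1 = M2"
    by (intro cdf_unique M1.real_distribution_axioms M2.real_distribution_axioms) auto
  show "\<mu> = density (restrict_space lborel {-1..1}) (\<lambda>x. ennreal (s x / 2))"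
  proof (rule measure_eqI)
    show "sets \<mu> = sets (density (restrict_space lborel {-1..1}) (\<lambda>x. ennreal (s x / 2)))"
      by (simp add: sets sets_restrict_space)
    fix E assume E: "E \<in> sets \<mu>"
    then have [measurable]: "E \<in> sets borel" and sub: "E \<subseteq> {-1..1}"
      by (auto simp: sets_iff)
    then have E': "E \<in> sets (restrict_space lborel {-1..1})"
      by (subst sets_restrict_space_iff) auto
    have "emeasure \<mu> E = emeasure M1 E"
      using sub by (simp add: M1_def emeasure_distr space Int_absorb2)
    also have "\<dots> = (\<integral>\<^sup>+x. ennreal (s x / 2) * indicator {-1..1} x * indicator E x \<partial>lborel)"
      unfolding M12 M2_def by (simp add: emeasure_density)
    also have "\<dots> = (\<integral>\<^sup>+x. ennreal (s x / 2) * indicator E x \<partial>restrict_space lborel {-1..1})"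
      by (simp add: nn_integral_restrict_space mult_ac)
    also have "\<dots> = emeasure (density (restrict_space lborel {-1..1}) (\<lambda>x. ennreal (s x / 2))) E"
      by (rule emeasure_density[symmetric]) (use E' in \<open>auto intro!: measurable_restrict_space1\<close>)
    finally show "emeasure \<mu> E = emeasure (density (restrict_space lborel {-1..1}) (\<lambda>x. ennreal (s x / 2))) E" .
  qed
qed

end

section \<open>Smoothness and derivative bounds for the invariant density\<close>

theorem theorem1:
  fixes n :: nat and l \<epsilon> :: real and a b p :: "nat \<Rightarrow> real"
    and h :: "real \<Rightarrow> real" and \<mu> :: "real measure"
  assumes "\<epsilon> > 0"
    and "0 < \<bar>l\<bar>" and "\<bar>l\<bar> < 1"
    and "\<And>k. k \<in> {1..n} \<Longrightarrow> b k \<noteq> 0"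
    and "\<And>k t. k \<in> {1..n} \<Longrightarrow> 0 \<le> t \<Longrightarrow> t \<le> \<epsilon> \<Longrightarrow> rifs_map l a b k t ` {-1..1} \<subseteq> {-1..1}"
    and "\<And>k. k \<in> {1..n} \<Longrightarrow> 0 < p k \<and> p k \<le> 1"
    and "(\<Sum>k=1..n. p k) = 1"
    and "smooth_real_on {0..\<epsilon>} h"
    and "\<And>t. t \<in> {0..\<epsilon>} \<Longrightarrow> 0 \<le> h t"
    and "(LBINT t:{0..\<epsilon>}. h t) = 1"
    and "invariant_prob n l a b p \<epsilon> h \<mu>"
  shows "absolutely_continuous (restrict_space lborel {-1..1}) \<mu> \<and>
    (\<exists>\<phi> :: real \<Rightarrow> real.
       smooth_real_on {-1..1} \<phi> \<and>
       (\<forall>x\<in>{-1..1}. 0 \<le> \<phi> x) \<and>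
       \<mu> = density (restrict_space lborel {-1..1}) (\<lambda>x. ennreal (\<phi> x)) \<and>
       (\<forall>k::nat. (SUP x\<in>{-1..1}. \<bar>nth_deriv_on {-1..1} k \<phi> x\<bar>)
          \<le> \<bar>l\<bar> powr (- (real ((k + 1) * (k + 2)) / 2)) *
            (\<Sum>i=1..n. p i / \<bar>b i\<bar> *
               (h \<epsilon> + h 0 + \<epsilon> * (SUP t\<in>{0..\<epsilon>}. \<bar>nth_deriv_on {0..\<epsilon>} 1 h t\<bar>))) ^ (k + 1)))"
proof -
  define S where "S = centered_cdf \<mu>"
  have prob: "prob_space \<mu>" and space: "space \<mu> = {-1..1}"
    and sets: "sets \<mu> = sets (restrict_space borel {-1..1})"
    using assms(11) by (auto simp: invariant_prob_def)
  have l: "l \<noteq> 0" and e: "0 \<le> \<epsilon>"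
    using assms(1,2) by auto
  define h' where "h' = nth_deriv_on {0..\<epsilon>} 1 h"
  have h: "(h has_real_derivative h' t) (at t within {0..\<epsilon>})" if "t \<in> {0..\<epsilon>}" for t
    using assms(8)[unfolded smooth_real_on_def, rule_format, of t 0] that
    by (simp add: h'_def has_real_derivative_iff_has_vector_derivative vector_derivative_works)
  have conth: "continuous_on {0..\<epsilon>} h"
    using h by (meson DERIV_continuous_on)
  have conth': "continuous_on {0..\<epsilon>} h'"
    using assms(8) unfolding h'_def smooth_real_on_def
    by (intro differentiable_imp_continuous_on) (unfold differentiable_on_def, blast)
  define M where "M = (SUP t\<in>{0..\<epsilon>}. \<bar>h' t\<bar>)"
  \<comment> \<open>A real \<open>SUP\<close> is an upper bound only of a family that is bounded
    above, which compactness supplies here.\<close>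
  have "compact ((\<lambda>t. \<bar>h' t\<bar>) ` {0..\<epsilon>})"
    by (intro compact_continuous_image continuous_intros conth') auto
  then have "bdd_above ((\<lambda>t. \<bar>h' t\<bar>) ` {0..\<epsilon>})"
    by (intro bounded_imp_bdd_above compact_imp_bounded)
  then have M: "\<bar>h' t\<bar> \<le> M" if "t \<in> {0..\<epsilon>}" for t
    unfolding M_def using that by (intro cSUP_upper)
  have M0: "0 \<le> M"
    using M[of 0] e by auto
  have hpos: "0 \<le> h 0" "0 \<le> h \<epsilon>"
    using assms(9) e by auto
  have p: "0 \<le> p k" if "k \<in> {1..n}" for k
    using assms(6)[OF that] by simp
  define C where "C = (\<Sum>i=1..n. p i / \<bar>b i\<bar> * (h \<epsilon> + h 0 + \<epsilon> * M))"
  have C0: "0 \<le> C"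
    unfolding C_def using p hpos M0 e by (intro sum_nonneg mult_nonneg_nonneg divide_nonneg_nonneg) auto
  have monoS: "mono S"
    unfolding S_def by (rule mono_centered_cdf[OF prob space sets])
  have S_le: "\<bar>S x\<bar> \<le> 1" for x
    unfolding S_def by (rule abs_centered_cdf_le[OF prob space sets])
  have eigS: "S x = sgn l * (\<Sum>k=1..n. p k * smear h \<epsilon> l (a k) (b k) S x)" for x
    unfolding S_def
    by (rule centered_cdf_invariant[OF prob space sets l conth assms(5) assms(11)])
  \<comment> \<open>\<open>S\<close> is only known to be monotone at this point. It equals an
    average of itself, and such averages are continuous.\<close>
  have "continuous_on UNIV (\<lambda>x. sgn l * (\<Sum>k=1..n. p k * smear h \<epsilon> l (a k) (b k) S x))"
    by (intro continuous_intros continuous_on_smear_mono[OF l assms(4) conth monoS S_le])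
  moreover have "(\<lambda>x. sgn l * (\<Sum>k=1..n. p k * smear h \<epsilon> l (a k) (b k) S x)) = S"
    by (rule ext) (rule eigS[symmetric])
  ultimately have contS: "continuous_on UNIV S"
    by (simp only:)
  define D where "D j = (deriv ^^ j) S" for j
  have D_Suc: "D (Suc j) = deriv (D j)" for j
    by (simp add: D_def)
  \<comment> \<open>Differentiating \<open>D i\<close> has eigenvalue \<open>sgn l / l ^ i\<close>
    and thus costs the factor \<open>C\<close> divided by the i-th power of
    \<open>\<bar>l\<bar>\<close>. Summing i over i < j gives the exponent j (j - 1) / 2.\<close>
  have D: "continuous_on UNIV (D j) \<and>
      (\<forall>x. D j x = sgn l / l ^ j * (\<Sum>k=1..n. p k * smear h \<epsilon> l (a k) (b k) (D j) x)) \<and>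
      (\<forall>x. \<bar>D j x\<bar> \<le> \<bar>l\<bar> powr (- (real j * (real j - 1) / 2)) * C ^ j)" for j
  proof (induction j)
    case 0
    have D0: "D 0 = S"
      by (simp add: D_def)
    show ?case
      unfolding D0
    proof (intro conjI allI contS)
      show "S x = sgn l / l ^ 0 * (\<Sum>k=1..n. p k * smear h \<epsilon> l (a k) (b k) S x)" for x
        using eigS[of x] by (simp only: power_0 div_by_1)
      show "\<bar>S x\<bar> \<le> \<bar>l\<bar> powr (- (real 0 * (real 0 - 1) / 2)) * C ^ 0" for x
        using S_le[of x] l by simp
    qed
  next
    case (Suc j)
    note IH = smear_eigenfunction_deriv[OF e l assms(4) p h conth' M hpos
        Suc[THEN conjunct1] Suc[THEN conjunct2, THEN conjunct2, rule_format]
        Suc[THEN conjunct2, THEN conjunct1, rule_format]]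
    have "\<bar>D (Suc j) x\<bar> \<le> \<bar>l\<bar> powr (- (real (Suc j) * (real (Suc j) - 1) / 2)) * C ^ Suc j" for x
    proof -
      have c: "\<bar>sgn l / l ^ j\<bar> = \<bar>l\<bar> powr (- real j)"
        using l by (simp add: abs_sgn_eq power_abs powr_minus powr_realpow divide_inverse abs_mult)
      have "\<bar>sgn l / l ^ j\<bar> * \<bar>l\<bar> powr (- (real j * (real j - 1) / 2))
          = \<bar>l\<bar> powr (- real j + - (real j * (real j - 1) / 2))"
        unfolding c by (rule powr_add[symmetric])
      also have "- real j + - (real j * (real j - 1) / 2) = - (real (Suc j) * (real (Suc j) - 1) / 2)"
        by (simp add: field_simps)
      finally have "\<bar>sgn l / l ^ j\<bar> * \<bar>l\<bar> powr (- (real j * (real j - 1) / 2))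
          = \<bar>l\<bar> powr (- (real (Suc j) * (real (Suc j) - 1) / 2))" .
      moreover have "\<bar>D (Suc j) x\<bar> \<le> \<bar>sgn l / l ^ j\<bar> * C *
          (\<bar>l\<bar> powr (- (real j * (real j - 1) / 2)) * C ^ j)"
        by (rule IH(4)[folded C_def D_Suc])
      ultimately show ?thesis
        by (metis (no_types, lifting) mult.assoc mult.commute power_Suc)
    qed
    moreover have "D (Suc j) x
        = sgn l / l ^ Suc j * (\<Sum>k=1..n. p k * smear h \<epsilon> l (a k) (b k) (D (Suc j)) x)" for x
      unfolding D_Suc power_Suc2 divide_divide_eq_left[symmetric] by (rule IH(3))
    moreover have "continuous_on UNIV (D (Suc j))"
      unfolding D_Suc by (rule IH(2))
    ultimately show ?case
      by (intro conjI allI)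
  qed
  have derD: "(D j has_real_derivative D (Suc j) x) (at x)" for j x
    unfolding D_Suc
    by (rule smear_eigenfunction_deriv(1)[OF e l assms(4) p h conth' M hpos
          D[THEN conjunct1] D[THEN conjunct2, THEN conjunct2, rule_format]
          D[THEN conjunct2, THEN conjunct1, rule_format]])
  \<comment> \<open>The density is half of the first derivative of \<open>S\<close>, hence the index
    shift: the k-th derivative of the density is half of \<open>D (Suc k)\<close>.\<close>
  define \<phi> where "\<phi> k x = D (Suc k) x / 2" for k x
  have der\<phi>: "(\<phi> k has_real_derivative \<phi> (Suc k) x) (at x)" for k x
    unfolding \<phi>_def[abs_def] by (intro DERIV_cdivide derD)
  have der1: "(centered_cdf \<mu> has_real_derivative D 1 x) (at x)" for x
    using derD[of 0 x] by (simp add: D_def S_def)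
  have cont1: "continuous_on UNIV (D 1)"
    using D by blast
  have \<phi>0_eq: "\<phi> 0 = (\<lambda>x. D 1 x / 2)"
    by (simp add: \<phi>_def[abs_def])
  have \<phi>0: "0 \<le> \<phi> 0 x" for x
    using density_of_deriv_centered_cdf(1)[OF prob space sets der1 cont1, of x] unfolding \<phi>0_eq
    by (rule divide_nonneg_nonneg) simp
  have dens: "\<mu> = density (restrict_space lborel {-1..1}) (\<lambda>x. ennreal (\<phi> 0 x))"
    unfolding \<phi>0_eq by (rule density_of_deriv_centered_cdf(2)[OF prob space sets der1 cont1])
  have "continuous_on UNIV (\<phi> 0)"
    using der\<phi> by (meson DERIV_isCont continuous_at_imp_continuous_on)
  then have "(\<lambda>x. ennreal (\<phi> 0 x)) \<in> borel_measurable (restrict_space lborel {-1..1})"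
    by (intro measurable_compose[OF _ measurable_ennreal] measurable_restrict_space1)
      (auto intro: borel_measurable_continuous_onI)
  then have ac: "absolutely_continuous (restrict_space lborel {-1..1}) \<mu>"
    by (subst dens) (rule absolutely_continuousI_density)
  have bound: "(SUP x\<in>{-1..1}. \<bar>nth_deriv_on {-1..1} k (\<phi> 0) x\<bar>)
      \<le> \<bar>l\<bar> powr (- (real ((k + 1) * (k + 2)) / 2)) * C ^ (k + 1)" for k
  proof (rule cSUP_least)
    fix x :: real assume x: "x \<in> {-1..1}"
    have "\<bar>nth_deriv_on {-1..1} k (\<phi> 0) x\<bar> = \<bar>D (Suc k) x\<bar> / 2"
      by (subst nth_deriv_on_eq[of \<phi>, OF der\<phi> _ x]) (simp_all add: \<phi>_def)
    also have "\<dots> \<le> \<bar>D (Suc k) x\<bar>"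
      by simp
    also have "\<dots> \<le> \<bar>l\<bar> powr (- (real (Suc k) * (real (Suc k) - 1) / 2)) * C ^ Suc k"
      using D by blast
    \<comment> \<open>The exponent obtained is k (k + 1) / 2. Since
      \<open>\<bar>l\<bar> < 1\<close>, raising it to (k + 1) (k + 2) / 2 only enlarges the
      bound.\<close>
    also have "\<dots> \<le> \<bar>l\<bar> powr (- (real ((k + 1) * (k + 2)) / 2)) * C ^ Suc k"
    proof (intro mult_right_mono powr_mono')
      show "- (real ((k + 1) * (k + 2)) / 2) \<le> - (real (Suc k) * (real (Suc k) - 1) / 2)"
        by (simp add: field_simps)
    qed (use assms(2,3) C0 in auto)
    finally show "\<bar>nth_deriv_on {-1..1} k (\<phi> 0) x\<bar>
        \<le> \<bar>l\<bar> powr (- (real ((k + 1) * (k + 2)) / 2)) * C ^ (k + 1)"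
      by simp
  qed simp
  have smooth: "smooth_real_on {-1..1} (\<phi> 0)"
    by (rule smooth_real_on_deriv_sequence[of \<phi>, OF der\<phi>]) simp
  show ?thesis
    using ac smooth \<phi>0 dens bound unfolding C_def M_def h'_def by blast
qed

end
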